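(* Let $G$ be any graph. Then $\gamma_R(\mu(G))=\gamma_R(G)+2$ if and only if $G$ is not a special Roman graph.
   Context: All graphs are finite and simple. A Roman dominating function (RDF) of $G=(V,E)$ is a function $f:V\to\{0,1,2\}$ such that every vertex $v$ with $f(v)=0$ has a neighbor $w$ with $f(w)=2$; its weight is $\sum_v f(v)$, $\gamma_R(G)$ is the minimum weight of an RDF, and a $\gamma_R$-function is an RDF of weight $\gamma_R(G)$. Write $f=(V_0,V_1,V_2)$ with $V_i=\{v:f(v)=i\}$. $G$ is a special Roman graph if it has a $\gamma_R$-function $f=(V_0,V_1,V_2)$ with $V_1=\emptyset$ such that $G[V_2]$ has no isolated vertex. The Mycielskian $\mu(G)$ of $G$ with $V(G)=\{v_1^0,\ldots,v_n^0\}$ has vertex set $\{v_j^0\}\cup\{v_j^1\}\cup\{u\}$ and edge set $E(G)\cup\{v_j^0v_{j'}^1 : v_j^0v_{j'}^0\in E(G)\}\cup\{v_j^1u: 1\leq j\leq n\}$. *)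

theory Defs
  imports "Graph_Theory.Graph_Theory"
begin

text \<open>
  A finite simple graph is a \<open>pair_graph\<close>: finite, loop-free, with a symmetric arc set, so that an
  edge \<open>{v, w}\<close> is the pair of arcs \<open>(v, w)\<close>, \<open>(w, v)\<close>. The graph without vertices is not excluded.
\<close>

definition roman_dominating :: "'a pair_pre_digraph \<Rightarrow> ('a \<Rightarrow> nat) \<Rightarrow> bool" where
  "roman_dominating G f \<longleftrightarrow>
     (\<forall>v\<in>pverts G. f v \<in> {0, 1, 2}) \<and>
     (\<forall>v\<in>pverts G. f v = 0 \<longrightarrow> (\<exists>w\<in>pverts G. v \<rightarrow>\<^bsub>with_proj G\<^esub> w \<and> f w = 2))"

definition roman_weight :: "'a pair_pre_digraph \<Rightarrow> ('a \<Rightarrow> nat) \<Rightarrow> nat" where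
  "roman_weight G f = (\<Sum>v\<in>pverts G. f v)"

definition roman_number :: "'a pair_pre_digraph \<Rightarrow> nat" where
  "roman_number G = (LEAST k. \<exists>f. roman_dominating G f \<and> roman_weight G f = k)"

definition roman_function :: "'a pair_pre_digraph \<Rightarrow> ('a \<Rightarrow> nat) \<Rightarrow> bool" where
  "roman_function G f \<longleftrightarrow> roman_dominating G f \<and> roman_weight G f = roman_number G"

definition level_set :: "'a pair_pre_digraph \<Rightarrow> ('a \<Rightarrow> nat) \<Rightarrow> nat \<Rightarrow> 'a set" where
  "level_set G f i = {v \<in> pverts G. f v = i}"

definition isolated_vertex :: "('a, 'b) pre_digraph \<Rightarrow> 'a \<Rightarrow> bool" where
  "isolated_vertex H v \<longleftrightarrow> v \<in> verts H \<and> (\<forall>w\<in>verts H. \<not> v \<rightarrow>\<^bsub>H\<^esub> w \<and> \<not> w \<rightarrow>\<^bsub>H\<^esub> v)"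

definition special_roman :: "'a pair_pre_digraph \<Rightarrow> bool" where
  "special_roman G \<longleftrightarrow>
     (\<exists>f. roman_function G f \<and> level_set G f 1 = {} \<and>
          \<not> (\<exists>v. isolated_vertex (with_proj G \<restriction> level_set G f 2) v))"

text \<open>\<open>Orig v\<close>, \<open>Copy v\<close> and \<open>Apex\<close> stand for $v^0$, $v^1$ and $u$ respectively.\<close>

datatype 'a mycielski_vertex = Orig 'a | Copy 'a | Apex

text \<open>Each family of edges is listed with both orientations.\<close>

definition mycielskian :: "'a pair_pre_digraph \<Rightarrow> 'a mycielski_vertex pair_pre_digraph" where
  "mycielskian G = \<lparr>
     pverts = Orig ` pverts G \<union> Copy ` pverts G \<union> {Apex},
     parcs = {(Orig v, Orig w) | v w. (v, w) \<in> parcs G}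
           \<union> {(Orig v, Copy w) | v w. (v, w) \<in> parcs G}
           \<union> {(Copy w, Orig v) | v w. (v, w) \<in> parcs G}
           \<union> {(Copy v, Apex) | v. v \<in> pverts G}
           \<union> {(Apex, Copy v) | v. v \<in> pverts G} \<rparr>"

lemma roman_function_exists: "\<exists>f. roman_function G f"
proof -
  have "roman_dominating G (\<lambda>_. 1)"
    by (simp add: roman_dominating_def)
  then have "\<exists>k f. roman_dominating G f \<and> roman_weight G f = k" by blast
  then show ?thesis
    unfolding roman_function_def roman_number_def by (rule LeastI_ex)
qed

lemma pair_graph_mycielskian:
  assumes "pair_graph G"
  shows "pair_graph (mycielskian G)"
proof -
  interpret pair_graph G by fact
  let ?M = "mycielskian G"
  have fin: "finite (pverts ?M)"
    by (simp add: mycielskian_def pair_finite_verts)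
  have sub: "parcs ?M \<subseteq> pverts ?M \<times> pverts ?M"
    by (auto simp: mycielskian_def dest: in_arcsD1 in_arcsD2)
  show ?thesis
  proof
    show "finite (parcs ?M)"
      using fin sub by (meson finite_SigmaI finite_subset)
    show "symmetric (with_proj ?M)"
      by (auto simp: symmetric_def sym_def mycielskian_def dest: arcs_symmetric)
    show "fst e \<noteq> snd e" if "e \<in> parcs ?M" for e
      using that by (auto simp: mycielskian_def dest: no_loops')
  qed (use fin sub in auto)
qed

end

theory Submission
  imports Defs
begin

text \<open>
  A Roman dominating function of \<open>G\<close> extends to \<open>\<mu>(G)\<close> with \<open>u \<mapsto> 2\<close> and \<open>v\<^sup>1 \<mapsto> 0\<close>; if it is
  special, \<open>u \<mapsto> 1\<close> is enough. Conversely, let \<open>g\<close> be a Roman dominating function of \<open>\<mu>(G)\<close>.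
  If \<open>g u = 0\<close>, collapse \<open>g\<close> to \<open>G\<close> keeping the value \<open>2\<close> only at the original vertices: this saves
  at least \<open>2\<close>, because of the copy \<open>z\<^sup>1\<close> of value \<open>2\<close> that dominates \<open>u\<close>. If \<open>g u > 0\<close>, give \<open>v\<close>
  the value \<open>2\<close> whenever \<open>v\<^sup>0\<close> or \<open>v\<^sup>1\<close> has it: this saves at least \<open>g u\<close>, and if it saves exactly
  \<open>1\<close> and is minimum, it witnesses that \<open>G\<close> is special.
\<close>

lemma roman_dominating_iff:
  "roman_dominating G f \<longleftrightarrow>
     (\<forall>v\<in>pverts G. f v \<le> 2 \<and> (f v = 0 \<longrightarrow> (\<exists>w\<in>pverts G. (v, w) \<in> parcs G \<and> f w = 2)))"
proof -
  have "n \<in> {0, 1, 2} \<longleftrightarrow> n \<le> 2" for n :: nat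
    by auto
  then show ?thesis
    unfolding roman_dominating_def by auto
qed

lemma roman_number_le: "roman_dominating G f \<Longrightarrow> roman_number G \<le> roman_weight G f"
  unfolding roman_number_def by (rule Least_le) blast

lemma isolated_vertex_induced_iff:
  "isolated_vertex (with_proj G \<restriction> S) v \<longleftrightarrow>
     v \<in> S \<and> (\<forall>w\<in>S. (v, w) \<notin> parcs G \<and> (w, v) \<notin> parcs G)"
  by (auto simp: isolated_vertex_def induce_subgraph_def arcs_ends_def arc_to_ends_def)

lemma special_roman_iff:
  assumes "pair_graph G"
  shows "special_roman G \<longleftrightarrow> (\<exists>f. roman_function G f \<and>
    (\<forall>v\<in>pverts G. f v \<noteq> 1 \<and> (f v = 2 \<longrightarrow> (\<exists>w\<in>pverts G. (v, w) \<in> parcs G \<and> f w = 2))))"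
proof -
  interpret pair_graph G by fact
  have "(w, v) \<in> parcs G \<longleftrightarrow> (v, w) \<in> parcs G" for v w
    using arcs_symmetric by blast
  then have "level_set G f 1 = {} \<and> \<not> (\<exists>v. isolated_vertex (with_proj G \<restriction> level_set G f 2) v) \<longleftrightarrow>
    (\<forall>v\<in>pverts G. f v \<noteq> 1 \<and> (f v = 2 \<longrightarrow> (\<exists>w\<in>pverts G. (v, w) \<in> parcs G \<and> f w = 2)))" for f
    unfolding isolated_vertex_induced_iff level_set_def by auto
  then show ?thesis
    unfolding special_roman_def by simp
qed

lemma roman_dominating_mycielskian_iff:
  assumes "pair_graph G"
  shows "roman_dominating (mycielskian G) g \<longleftrightarrow>
    (\<forall>v\<in>pverts G. g (Orig v) \<le> 2 \<and> g (Copy v) \<le> 2 \<and>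
       (g (Orig v) = 0 \<longrightarrow>
          (\<exists>w\<in>pverts G. (v, w) \<in> parcs G \<and> (g (Orig w) = 2 \<or> g (Copy w) = 2))) \<and>
       (g (Copy v) = 0 \<longrightarrow>
          g Apex = 2 \<or> (\<exists>w\<in>pverts G. (v, w) \<in> parcs G \<and> g (Orig w) = 2))) \<and>
    g Apex \<le> 2 \<and> (g Apex = 0 \<longrightarrow> (\<exists>v\<in>pverts G. g (Copy v) = 2))"
proof -
  interpret pair_graph G by fact
  \<comment> \<open>An arc \<open>(Copy w, Orig v)\<close> stems from \<open>(v, w)\<close>, so
    symmetry is needed to read off the neighbours of a copy in the stated orientation.\<close>
  have "(w, v) \<in> parcs G \<longleftrightarrow> (v, w) \<in> parcs G" for v w
    using arcs_symmetric by blast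
  then show ?thesis
    unfolding roman_dominating_iff mycielskian_def
    by (simp add: ball_Un bex_Un conj_disj_distribL conj_disj_distribR bex_disj_distrib) blast
qed

lemma roman_weight_mycielskian:
  assumes "finite (pverts G)"
  shows "roman_weight (mycielskian G) g = (\<Sum>v\<in>pverts G. g (Orig v) + g (Copy v)) + g Apex"
proof -
  have "roman_weight (mycielskian G) g
      = sum g (Orig ` pverts G) + sum g (Copy ` pverts G) + g Apex"
    unfolding roman_weight_def mycielskian_def using assms
    by (simp, subst sum.insert, auto intro!: sum.union_disjoint)
  then show ?thesis
    by (simp add: sum.reindex inj_on_def sum.distrib)
qed

lemma roman_number_mycielskian_le:
  assumes "pair_graph G"
  shows "roman_number (mycielskian G) \<le> roman_number G + 2"
proof -
  interpret pair_graph G by fact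
  obtain f where f: "roman_function G f"
    using roman_function_exists by blast
  define g where "g = case_mycielski_vertex f (\<lambda>_. 0) (2::nat)"
  have "roman_dominating (mycielskian G) g"
    using f unfolding roman_dominating_mycielskian_iff[OF assms] roman_function_def g_def
    by (auto simp: roman_dominating_iff)
  moreover have "roman_weight (mycielskian G) g = roman_number G + 2"
    using f unfolding roman_weight_mycielskian[OF pair_finite_verts] roman_function_def g_def
    by (simp add: roman_weight_def)
  ultimately show ?thesis
    using roman_number_le by metis
qed

lemma special_roman_imp_roman_number_mycielskian_le:
  assumes "pair_graph G" and "special_roman G"
  shows "roman_number (mycielskian G) \<le> roman_number G + 1"
proof -
  interpret pair_graph G by fact
  obtain f where f: "roman_function G f"
    and two: "\<And>v. v \<in> pverts G \<Longrightarrow>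
      f v \<noteq> 1 \<and> (f v = 2 \<longrightarrow> (\<exists>w\<in>pverts G. (v, w) \<in> parcs G \<and> f w = 2))"
    using assms special_roman_iff by blast
  define g where "g = case_mycielski_vertex f (\<lambda>_. 0) (1::nat)"
  \<comment> \<open>With value 1 excluded, every vertex has a neighbour of value 2, whatever its own
    value. The originals thus dominate all copies, and \<open>Apex\<close> can do with 1.\<close>
  have dom: "f v \<le> 2 \<and> (\<exists>w\<in>pverts G. (v, w) \<in> parcs G \<and> f w = 2)" if "v \<in> pverts G" for v
  proof -
    have "f v \<in> {0, 1, 2}"
      using f that by (simp add: roman_function_def roman_dominating_def)
    then show ?thesis
      using f two[OF that] that unfolding roman_function_def roman_dominating_iff by auto
  qed
  then have "roman_dominating (mycielskian G) g"
    unfolding roman_dominating_mycielskian_iff[OF assms(1)] g_def by auto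
  moreover have "roman_weight (mycielskian G) g = roman_number G + 1"
    using f unfolding roman_weight_mycielskian[OF pair_finite_verts] roman_function_def g_def
    by (simp add: roman_weight_def)
  ultimately show ?thesis
    using roman_number_le by metis
qed

lemma roman_weight_mycielskian_ge_Apex_0:
  assumes "pair_graph G" and "roman_dominating (mycielskian G) g" and "g Apex = 0"
  shows "roman_number G + 2 \<le> roman_weight (mycielskian G) g"
proof -
  interpret pair_graph G by fact
  note g = assms(2)[unfolded roman_dominating_mycielskian_iff[OF assms(1)]]
  define h :: "'a \<Rightarrow> nat" where
    "h v = (if g (Orig v) = 2 then 2
            else if \<exists>w\<in>pverts G. (v, w) \<in> parcs G \<and> g (Orig w) = 2 then 0 else 1)" for v
  define d where "d v = g (Orig v) + g (Copy v) - h v" for v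
  have "roman_dominating G h"
    unfolding roman_dominating_iff h_def by auto
  then have "roman_number G \<le> sum h (pverts G)"
    using roman_number_le by (metis roman_weight_def)
  \<comment> \<open>If \<open>h v = 1\<close>, no original next to \<open>v\<close> has value 2 and
    neither has \<open>Apex\<close>, so \<open>g (Copy v)\<close> cannot be 0.\<close>
  moreover have h_le: "h v \<le> g (Orig v) + g (Copy v)" if "v \<in> pverts G" for v
    using g that \<open>g Apex = 0\<close> by (auto simp: h_def)
  \<comment> \<open>The truncated subtraction in \<open>d\<close> is exact by
    \<open>h_le\<close>.\<close>
  have d: "g (Orig v) + g (Copy v) = h v + d v" if "v \<in> pverts G" for v
    using h_le[OF that] by (simp add: d_def)
  have "2 \<le> sum d (pverts G)"
  proof -
    obtain z where z: "z \<in> pverts G" "g (Copy z) = 2"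
      using g \<open>g Apex = 0\<close> by blast
    \<comment> \<open>If \<open>h v = 2\<close>, the original has value 2 as well and the excess is
      2; otherwise \<open>h v \<le> 1\<close>.\<close>
    have d_pos: "1 \<le> d v" if "g (Copy v) = 2" for v
      using that by (auto simp: d_def h_def)
    show ?thesis
    proof (cases "2 \<le> d z")
      case True
      also have "d z \<le> sum d (pverts G)"
        using z by (intro member_le_sum) auto
      finally show ?thesis .
    next
      case False
      \<comment> \<open>Any other values would give \<open>d z \<ge> 2\<close>. Since
        \<open>h z = 1\<close> rules out originals, \<open>Orig z\<close> is dominated by a copy of
        value 2 at some \<open>y \<noteq> z\<close>, which supplies the second unit.\<close>
      have "h z = 1" "g (Orig z) = 0"
        using False z by (auto simp: d_def h_def split: if_splits)
      then obtain y where y: "y \<in> pverts G" "(z, y) \<in> parcs G" "g (Copy y) = 2"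
        using g z(1) by (fastforce simp: h_def split: if_splits)
      then have "y \<noteq> z"
        using no_loops' by blast
      then have "2 \<le> sum d {y, z}"
        using d_pos[OF y(3)] d_pos[OF z(2)] by simp
      also have "\<dots> \<le> sum d (pverts G)"
        using y z by (intro sum_mono2) auto
      finally show ?thesis .
    qed
  qed
  moreover have "roman_weight (mycielskian G) g = sum h (pverts G) + sum d (pverts G)"
    using \<open>g Apex = 0\<close> d by (simp add: roman_weight_mycielskian flip: sum.distrib)
  ultimately show ?thesis
    by simp
qed

lemma roman_weight_mycielskian_ge_Apex_pos:
  assumes "pair_graph G" and "roman_dominating (mycielskian G) g" and "g Apex \<noteq> 0"
    and "\<not> special_roman G"
  shows "roman_number G + 2 \<le> roman_weight (mycielskian G) g"
proof (rule ccontr)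
  interpret pair_graph G by fact
  assume less: "\<not> ?thesis"
  note g = assms(2)[unfolded roman_dominating_mycielskian_iff[OF assms(1)]]
  define f :: "'a \<Rightarrow> nat" where
    "f v = (if g (Orig v) = 2 \<or> g (Copy v) = 2 then 2
            else if \<exists>w\<in>pverts G. (v, w) \<in> parcs G \<and> (g (Orig w) = 2 \<or> g (Copy w) = 2)
            then 0 else 1)" for v
  have dom: "roman_dominating G f"
    unfolding roman_dominating_iff f_def by auto
  \<comment> \<open>If \<open>f v = 1\<close>, neither layer has a 2 next to \<open>v\<close>, so
    \<open>g (Orig v)\<close> cannot be 0.\<close>
  have f_le: "f v \<le> g (Orig v) + g (Copy v)" if "v \<in> pverts G" for v
    using g that by (auto simp: f_def)
  have weight: "roman_weight (mycielskian G) g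
      = (\<Sum>v\<in>pverts G. g (Orig v) + g (Copy v)) + g Apex"
    by (simp add: roman_weight_mycielskian)
  have min: "roman_number G \<le> sum f (pverts G)"
    using roman_number_le[OF dom] by (simp add: roman_weight_def)
  have le: "sum f (pverts G) \<le> (\<Sum>v\<in>pverts G. g (Orig v) + g (Copy v))"
    using f_le by (rule sum_mono)
  \<comment> \<open>The weight is at most \<open>roman_number G + 1\<close> and \<open>Apex\<close>
    takes at least 1 of it, so \<open>min\<close> and \<open>le\<close> are both equalities.\<close>
  have "g Apex = 1" and number: "sum f (pverts G) = roman_number G"
    and eq: "sum f (pverts G) = (\<Sum>v\<in>pverts G. g (Orig v) + g (Copy v))"
    using less weight min le \<open>g Apex \<noteq> 0\<close> by linarith+
  have f_eq: "f v = g (Orig v) + g (Copy v)" if "v \<in> pverts G" for v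
    using sum_mono_inv[OF eq f_le that] by simp
  have special: "f v \<noteq> 1 \<and> (f v = 2 \<longrightarrow> (\<exists>w\<in>pverts G. (v, w) \<in> parcs G \<and> f w = 2))"
    if v: "v \<in> pverts G" for v
  proof (cases "\<exists>w\<in>pverts G. (v, w) \<in> parcs G \<and> (g (Orig w) = 2 \<or> g (Copy w) = 2)")
    case True
    then show ?thesis
      by (auto simp: f_def)
  next
    \<comment> \<open>This case is contradictory. As \<open>Apex\<close> has only 1, both values at
      \<open>v\<close> are nonzero, so their sum \<open>f v\<close> is 2; but then
      \<open>f_def\<close> makes one of them 2 and the sum at least 3.\<close>
    case False
    then have "g (Orig v) \<noteq> 0" "g (Copy v) \<noteq> 0"
      using g v \<open>g Apex = 1\<close> by auto
    then show ?thesis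
      using f_eq[OF v] False by (auto simp: f_def split: if_splits)
  qed
  have "roman_function G f"
    using dom number by (simp add: roman_function_def roman_weight_def)
  then have "special_roman G"
    using special special_roman_iff[OF assms(1)] by blast
  with assms(4) show False ..
qed

theorem theorem6:
  fixes G :: "'a pair_pre_digraph"
  assumes "pair_graph G"
  shows "roman_number (mycielskian G) = roman_number G + 2 \<longleftrightarrow> \<not> special_roman G"
proof
  assume "roman_number (mycielskian G) = roman_number G + 2"
  then show "\<not> special_roman G"
    using special_roman_imp_roman_number_mycielskian_le[OF assms] by auto
next
  assume not_special: "\<not> special_roman G"
  obtain g where "roman_function (mycielskian G) g"
    using roman_function_exists by blast
  then have "roman_number G + 2 \<le> roman_number (mycielskian G)"
    using roman_weight_mycielskian_ge_Apex_0[OF assms, of g]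
      roman_weight_mycielskian_ge_Apex_pos[OF assms _ _ not_special, of g]
    unfolding roman_function_def by fastforce
  then show "roman_number (mycielskian G) = roman_number G + 2"
    using roman_number_mycielskian_le[OF assms] by simp
qed

end
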